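(* Let $f\in\mathscr{F}$ be a meromorphic function $f:\mathbb{C}^n\to\mathbb{C}^k$ with a single pole at $0$ of order at most $1$ and with residue matrix $\eta$. If $\sigma_\lambda$ is the standard error of $f$ under the exterior probability $\mu^n_\lambda$, then $$\lambda\,\sigma_\lambda\ \geq\ \sqrt{\mathrm{Tr}(\eta^*\eta)}.$$
   Context: Exterior probability. For $\lambda>0$ and an interval $I\subset[-\pi,\pi]$, put $\Gamma_\lambda(I)=\{w\in\mathbb{C}: |w|\le\lambda,\ \arg(w)\in I\}$ and $\gamma_\lambda(I)=\{w\in\mathbb{C}: |w|=\lambda,\ \arg(w)\in I\}$ (traversed counterclockwise). Let $\mathscr{E}_\lambda$ be the $\sigma$-algebra on $\{|w|\le\lambda\}$ generated by all $\Gamma_\lambda(I)$, and $\mu_\lambda$ the measure on $\mathscr{E}_\lambda$ extending $\mu_\lambda(\Gamma_\lambda(I))=\frac{1}{2\pi i}\int_{\gamma_\lambda(I)}\frac{dw}{w}$. $(\mathscr{E}^n_\lambda,\mu^n_\lambda)$ is the $n$-fold product on the closed poly-disc $D^n_\lambda=D_\lambda=\{w\in\mathbb{C}^n:|w_\alpha|\le\lambda\ \forall\alpha\}$; $\mu^n_\lambda$ is the exterior probability. Contour integral convention. $\oint_{D_\lambda}F$ denotes the iterated contour integral of $F(w)\,dw_1\cdots dw_n$ over $\{|w_1|=\lambda\}\times\cdots\times\{|w_n|=\lambda\}$. Functions. $\mathscr{F}$ is the vector space of all meromorphic functions $f:\mathbb{C}^n\to\mathbb{C}^k$ which have a potential pole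 of order at most $1$ at $0$ and are $\mu^n_\lambda$-measurable over $D^n_\lambda$. Expectation and inner product are $$E(f)=\int_{D_\lambda}f\,d\mu^n_\lambda=\frac{1}{(2\pi i)^n}\oint_{D_\lambda}\frac{f(w)}{\prod_\alpha w_\alpha},\qquad \langle f,g\rangle=\int_{D_\lambda}f^*g\,d\mu^n_\lambda=\frac{1}{(2\pi i)^n}\oint_{D_\lambda}\frac{f(w)^*g(w)}{\prod_\alpha w_\alpha},$$ where $^*$ is conjugate transpose. The variance is $V_\lambda(f)=\langle f,f\rangle-\|E(f)\|^2$ and $\sigma_\lambda=\sqrt{V_\lambda(f)}$. Decomposition. $f=f_0+f_P+f_A$, where $f_0^\alpha=\frac{1}{(2\pi i)^n}\oint_{D_\lambda}\frac{f^\alpha(w)}{\prod_{\mu}w_\mu}$ is the core; $f_P^\alpha=\sum_{\beta=1}^n\frac{\eta^\alpha_\beta}{w_\beta}$ is the principal component, with residue matrix $\eta^\alpha_\beta=\frac{1}{(2\pi i)^n}\oint_{D_\lambda}\frac{f^\alpha(w)}{\prod_{\mu\ne\beta}w_\mu}$; and $f_A=f-f_0-f_P$, the analytic component, is given by a power series convergent for $|w_\beta|<R$ (all $\beta$), for some radius $R$. *)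

theory Defs
  imports "HOL-Complex_Analysis.Complex_Analysis"
begin

section \<open>Exterior probability\<close>

text \<open>The argument is the principal one, with values in the half-open interval from
  \<open>-\<pi>\<close> (excluded) to \<open>\<pi>\<close> (included), and \<open>Arg 0 = 0\<close>.\<close>

definition sector :: "real \<Rightarrow> real set \<Rightarrow> complex set" where
  "sector lam I = {w. norm w \<le> lam \<and> Arg w \<in> I}"

definition arc :: "real \<Rightarrow> real set \<Rightarrow> real \<Rightarrow> complex" where
  "arc lam I = part_circlepath 0 lam (Inf I) (Sup I)"

definition arg_intervals :: "real set set" where
  "arg_intervals = {I. is_interval I \<and> I \<noteq> {} \<and> I \<subseteq> {-pi..pi}}"

definition exterior_prob1 :: "real \<Rightarrow> complex measure" where
  "exterior_prob1 lam =
     extend_measure (cball 0 lam) arg_intervals (sector lam)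
       (\<lambda>I. ennreal (Re (1 / (2 * of_real pi * \<i>) * contour_integral (arc lam I) (\<lambda>w. 1 / w))))"

definition exterior_prob :: "real \<Rightarrow> (complex ^ 'n) measure" where
  "exterior_prob lam = embed_measure (Pi\<^sub>M (UNIV :: 'n set) (\<lambda>_. exterior_prob1 lam)) vec_lambda"

text \<open>Every set of the sector \<open>\<sigma>\<close>-algebra is a union of rays, so a function on the poly-disc which
  is literally measurable for its \<open>n\<close>-fold product is constant along rays, and no nonconstant
  meromorphic function is.  As prescribed by the contour integral formula for the expectation,
  \<open>f\<close> is measured and integrated through its values on the distinguished boundary
  \<open>{w. \<forall>\<alpha>. norm (w $ \<alpha>) = lam}\<close>: the integrand at \<open>w\<close> is the value of \<open>f\<close> at the radial
  projection of \<open>w\<close>.\<close>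

definition boundary_proj :: "real \<Rightarrow> complex ^ 'n \<Rightarrow> complex ^ 'n" where
  "boundary_proj lam w = (\<chi> \<alpha>. of_real lam * cis (Arg (w $ \<alpha>)))"

definition exterior_measurable :: "real \<Rightarrow> (complex ^ 'n \<Rightarrow> complex ^ 'k) \<Rightarrow> bool" where
  "exterior_measurable lam f \<longleftrightarrow>
     (\<lambda>w. f (boundary_proj lam w)) \<in> borel_measurable (exterior_prob lam)"

definition expectation :: "real \<Rightarrow> (complex ^ 'n \<Rightarrow> complex ^ 'k) \<Rightarrow> complex ^ 'k" where
  "expectation lam f = (LINT w|exterior_prob lam. f (boundary_proj lam w))"

definition inner_prod ::
    "real \<Rightarrow> (complex ^ 'n \<Rightarrow> complex ^ 'k) \<Rightarrow> (complex ^ 'n \<Rightarrow> complex ^ 'k) \<Rightarrow> complex" where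
  "inner_prod lam f g =
     (LINT w|exterior_prob lam.
        (\<Sum>\<alpha>\<in>UNIV. cnj (f (boundary_proj lam w) $ \<alpha>) * g (boundary_proj lam w) $ \<alpha>))"

definition ext_variance :: "real \<Rightarrow> (complex ^ 'n \<Rightarrow> complex ^ 'k) \<Rightarrow> real" where
  "ext_variance lam f = Re (inner_prod lam f f) - (norm (expectation lam f))\<^sup>2"

definition std_error :: "real \<Rightarrow> (complex ^ 'n \<Rightarrow> complex ^ 'k) \<Rightarrow> real" where
  "std_error lam f = sqrt (ext_variance lam f)"


section \<open>Iterated contour integrals and the residue matrix\<close>

primrec iterated_contour ::
    "real \<Rightarrow> 'n list \<Rightarrow> (complex ^ 'n \<Rightarrow> complex) \<Rightarrow> complex ^ 'n \<Rightarrow> complex" where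
  "iterated_contour lam [] F w = F w"
| "iterated_contour lam (b # bs) F w =
     contour_integral (circlepath 0 lam)
       (\<lambda>z. iterated_contour lam bs F (\<chi> \<alpha>. if \<alpha> = b then z else w $ \<alpha>))"

text \<open>The index type carries no order; an arbitrary enumeration of the coordinates is fixed.
  By Fubini the choice is immaterial for integrands continuous on the torus.  The base point \<open>0\<close>
  is overwritten in every coordinate.\<close>

definition torus_integral :: "real \<Rightarrow> (complex ^ 'n \<Rightarrow> complex) \<Rightarrow> complex" where
  "torus_integral lam F =
     iterated_contour lam (SOME bs. distinct bs \<and> set bs = (UNIV :: 'n set)) F 0"

definition residue_matrix :: "real \<Rightarrow> (complex ^ 'n \<Rightarrow> complex ^ 'k) \<Rightarrow> complex ^ 'n ^ 'k" where
  "residue_matrix lam f =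
     (\<chi> \<alpha> \<beta>. 1 / (2 * of_real pi * \<i>) ^ CARD('n) *
        torus_integral lam (\<lambda>w. f w $ \<alpha> / (\<Prod>\<mu>\<in>UNIV - {\<beta>}. w $ \<mu>)))"

definition conj_transpose :: "complex ^ 'n ^ 'k \<Rightarrow> complex ^ 'k ^ 'n" where
  "conj_transpose A = (\<chi> i j. cnj (A $ j $ i))"


section \<open>Meromorphic functions of several variables\<close>

definition polydisc :: "complex ^ 'n \<Rightarrow> real \<Rightarrow> (complex ^ 'n) set" where
  "polydisc z R = {w. \<forall>\<beta>. norm (w $ \<beta> - z $ \<beta>) < R}"

definition power_series_on :: "(complex ^ 'n \<Rightarrow> complex) \<Rightarrow> complex ^ 'n \<Rightarrow> real \<Rightarrow> bool" where
  "power_series_on g z R \<longleftrightarrow>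
     (\<exists>a :: ('n \<Rightarrow> nat) \<Rightarrow> complex. \<forall>w\<in>polydisc z R.
        ((\<lambda>m. a m * (\<Prod>\<beta>\<in>UNIV. (w $ \<beta> - z $ \<beta>) ^ m \<beta>)) has_sum g w) UNIV)"

definition mv_analytic_at :: "(complex ^ 'n \<Rightarrow> complex ^ 'k) \<Rightarrow> complex ^ 'n \<Rightarrow> bool" where
  "mv_analytic_at f z \<longleftrightarrow> (\<exists>R>0. \<forall>\<alpha>. power_series_on (\<lambda>w. f w $ \<alpha>) z R)"

text \<open>Locally a quotient of analytic functions whose denominator does not vanish identically.
  Values on the zero set of the denominator are not constrained.\<close>

definition mv_meromorphic :: "(complex ^ 'n \<Rightarrow> complex ^ 'k) \<Rightarrow> bool" where
  "mv_meromorphic f \<longleftrightarrow>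
     (\<forall>z \<alpha>. \<exists>R>0. \<exists>p q. power_series_on p z R \<and> power_series_on q z R \<and>
        (\<exists>w\<in>polydisc z R. q w \<noteq> 0) \<and>
        (\<forall>w\<in>polydisc z R. q w \<noteq> 0 \<longrightarrow> f w $ \<alpha> = p w / q w))"

text \<open>A potential pole of order at most 1 at 0: near 0, \<open>f\<close> is a principal component
  \<open>\<Sum>\<beta>. e\<^sub>\<beta> / w\<^sub>\<beta>\<close> plus a convergent power series.  Near 0 the polar
  set is then contained in the union of the coordinate hyperplanes.\<close>

definition pole_order_le_1_at_0 :: "(complex ^ 'n \<Rightarrow> complex ^ 'k) \<Rightarrow> bool" where
  "pole_order_le_1_at_0 f \<longleftrightarrow>
     (\<exists>R>0. \<exists>e :: complex ^ 'n ^ 'k. \<exists>g :: complex ^ 'n \<Rightarrow> complex ^ 'k.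
        (\<forall>\<alpha>. power_series_on (\<lambda>w. g w $ \<alpha>) 0 R) \<and>
        (\<forall>w\<in>polydisc 0 R. (\<forall>\<beta>. w $ \<beta> \<noteq> 0) \<longrightarrow>
           (\<forall>\<alpha>. f w $ \<alpha> = (\<Sum>\<beta>\<in>UNIV. e $ \<alpha> $ \<beta> / w $ \<beta>) + g w $ \<alpha>)))"

text \<open>No poles other than the one at 0.  In more than one variable a pole is never an isolated
  point, so the pole at 0 comprises the coordinate hyperplanes, the polar set of the principal
  component.\<close>

definition single_pole_at_0 :: "(complex ^ 'n \<Rightarrow> complex ^ 'k) \<Rightarrow> bool" where
  "single_pole_at_0 f \<longleftrightarrow> (\<forall>z. (\<forall>\<beta>. z $ \<beta> \<noteq> 0) \<longrightarrow> mv_analytic_at f z)"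

definition F_space :: "real \<Rightarrow> (complex ^ 'n \<Rightarrow> complex ^ 'k) set" where
  "F_space lam = {f. mv_meromorphic f \<and> pole_order_le_1_at_0 f \<and> exterior_measurable lam f}"

end

(*
  On the distinguished torus |w_b| = lam the functions 1 and lam / w_b (for the coordinates b) are
  characters, hence orthonormal for the exterior probability.  The coefficient of f_a along 1 is
  its expectation; the coefficient along lam / w_b is E(w_b f_a) / lam = eta_ab / lam, because the
  factor w_b turns the normalised measure into the contour integral that defines the residue.
  Bessel's inequality for each component f_a, summed over a, is the theorem.  The absence of poles
  on the torus only serves to make f continuous, hence bounded, there.
*)

theory Submission
  imports Defs "HOL-Probability.Infinite_Product_Measure"
begin

section \<open>The exterior probability as the law of a uniform angle\<close>

text \<open>Two obstacles shape the proof. \<open>extend_measure\<close> takes the prescribed values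
  on sectors only if some measure with these values exists, so one is exhibited: the law of
  \<open>lam * cis t\<close> for an angle \<open>t\<close> uniform on the range of
  \<open>Arg\<close>. Moreover, the sector sigma-algebra distinguishes points only by their
  argument, and integrands are controlled only on the circle or torus; so integrands are evaluated
  at radial projections, and measurability and bounds are asked of the composites. Contour integrals
  over the torus are iterated one-variable integrals, so identifying them with integrals over the
  product measure takes an induction on the coordinates with Fubini, in which the inner integrals
  must be shown to be measurable functions of the outer variable.\<close>

definition angle_measure :: "real measure" where
  "angle_measure = density lborel (\<lambda>t. ennreal (indicator {-pi<..pi} t / (2 * pi)))"

text \<open>One coordinate of \<open>boundary_proj\<close>, since the product measure is treated
  factor by factor. It depends on \<open>z\<close> through \<open>Arg\<close> alone, so it is
  measurable for the sector sigma-algebra, which the identity is not.\<close>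

definition radial_proj :: "real \<Rightarrow> complex \<Rightarrow> complex" where
  "radial_proj lam z = of_real lam * cis (Arg z)"

lemma boundary_proj_eq: "boundary_proj lam w = (\<chi> \<alpha>. radial_proj lam (w $ \<alpha>))"
  by (simp add: boundary_proj_def radial_proj_def)

lemma borel_measurable_Arg [measurable]: "Arg \<in> borel_measurable borel"
proof -
  have "Arg = (\<lambda>z. if z = 0 then 0 else Im (Ln z))"
    by (auto simp: Arg_eq_Im_Ln Arg_zero)
  moreover have "(\<lambda>z. if z = 0 then 0 else Im (Ln z)) \<in> borel_measurable borel"
    by measurable
  ultimately show ?thesis by simp
qed

lemma borel_measurable_cis [measurable]: "cis \<in> borel_measurable borel"
  by (intro borel_measurable_continuous_onI continuous_intros)

lemma borel_measurable_radial_proj [measurable]: "radial_proj lam \<in> borel_measurable borel"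
  unfolding radial_proj_def by measurable

lemma norm_radial_proj [simp]: "lam > 0 \<Longrightarrow> norm (radial_proj lam z) = lam"
  by (simp add: radial_proj_def norm_mult)

text \<open>The half-open interval is the range of \<open>Arg\<close>, which is why
  \<open>angle_measure\<close> lives on it.\<close>

lemma Arg_scaled_cis: "lam > 0 \<Longrightarrow> t \<in> {-pi<..pi} \<Longrightarrow> Arg (of_real lam * cis t) = t"
  by (simp add: Arg_times_of_real Arg_cis)

lemma radial_proj_scaled_cis:
  assumes "lam > 0" shows "radial_proj lam (of_real lam * cis t) = of_real lam * cis t"
  using assms by (simp add: radial_proj_def cis_Arg sgn_mult sgn_of_real)

lemma radial_proj_idem:
  "lam > 0 \<Longrightarrow> radial_proj lam (radial_proj lam z) = radial_proj lam z"
  by (metis radial_proj_def radial_proj_scaled_cis)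

lemma sets_angle_measure [simp, measurable_cong]: "sets angle_measure = sets borel"
  by (simp add: angle_measure_def)

lemma space_angle_measure [simp]: "space angle_measure = UNIV"
  by (simp add: angle_measure_def)

lemma emeasure_angle_measure:
  assumes [measurable]: "A \<in> sets borel"
  shows "emeasure angle_measure A = emeasure lborel (A \<inter> {-pi<..pi}) / ennreal (2 * pi)"
proof -
  have "emeasure angle_measure A
      = (\<integral>\<^sup>+t. ennreal (indicator {-pi<..pi} t / (2 * pi)) * indicator A t \<partial>lborel)"
    unfolding angle_measure_def by (rule emeasure_density) auto
  also have "\<dots> = (\<integral>\<^sup>+t. indicator (A \<inter> {-pi<..pi}) t / ennreal (2 * pi) \<partial>lborel)"
    by (intro nn_integral_cong) (auto simp: indicator_def divide_ennreal[symmetric])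
  also have "\<dots> = emeasure lborel (A \<inter> {-pi<..pi}) / ennreal (2 * pi)"
    by (simp add: nn_integral_divide)
  finally show ?thesis .
qed

lemma prob_space_angle_measure: "prob_space angle_measure"
  by (rule prob_spaceI) (simp add: emeasure_angle_measure ennreal_divide_self)

lemma integral_angle_measure:
  fixes g :: "real \<Rightarrow> complex"
  assumes [measurable]: "g \<in> borel_measurable borel" and bound: "\<And>t. norm (g t) \<le> B"
  shows "integral\<^sup>L angle_measure g = integral {-pi..pi} g / (2 * pi)"
proof -
  have "integral\<^sup>L angle_measure g
      = (LINT t|lborel. (indicator {-pi<..pi} t / (2 * pi)) *\<^sub>R g t)"
    unfolding angle_measure_def by (rule integral_density) auto
  also have "\<dots> = (LINT t|lborel. (indicator {-pi..pi} t *\<^sub>R g t) / (2 * pi))"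
  proof (rule integral_cong_AE)
    \<comment> \<open>The half-open and the closed interval differ only in the null set
      \<open>{-pi}\<close>.\<close>
    show "AE t in lborel. (indicator {-pi<..pi} t / (2 * pi)) *\<^sub>R g t
        = (indicator {-pi..pi} t *\<^sub>R g t) / (2 * pi)"
      using AE_lborel_singleton[of "-pi"]
      by eventually_elim (auto simp: indicator_def scaleR_conv_of_real)
  qed auto
  also have "\<dots> = (LINT t:{-pi..pi}|lborel. g t) / (2 * pi)"
    by (simp add: set_lebesgue_integral_def)
  also have "(LINT t:{-pi..pi}|lborel. g t) = integral {-pi..pi} g"
    unfolding set_lebesgue_integral_def[symmetric]
    by (intro set_borel_integral_eq_integral)
      (auto simp: set_integrable_def intro!: integrableI_bounded_set_indicator[where B = B] bound)
  finally show ?thesis .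
qed

text \<open>Members of \<open>arg_intervals\<close> may contain either, both or none of their
  endpoints. Squeezing them between the open and the closed interval avoids the case distinction and
  still determines the length.\<close>

lemma bounded_interval_sandwich:
  assumes "I \<in> arg_intervals"
  shows "{Inf I<..<Sup I} \<subseteq> I" "I \<subseteq> {Inf I..Sup I}" "-pi \<le> Inf I" "Sup I \<le> pi" "Inf I \<le> Sup I"
proof -
  have I: "is_interval I" "I \<noteq> {}" "I \<subseteq> {-pi..pi}"
    using assms by (auto simp: arg_intervals_def)
  then have bd: "bdd_below I" "bdd_above I"
    by (meson bdd_below_Icc bdd_below_mono bdd_above_Icc bdd_above_mono)+
  show sub: "I \<subseteq> {Inf I..Sup I}"
    using bd by (auto intro: cInf_lower cSup_upper)
  show "{Inf I<..<Sup I} \<subseteq> I"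
  proof
    fix t assume "t \<in> {Inf I<..<Sup I}"
    then obtain a b where "a \<in> I" "a < t" "b \<in> I" "t < b"
      using I bd by (auto simp: cInf_less_iff less_cSup_iff)
    thus "t \<in> I" using I(1) by (meson is_interval_1 less_imp_le)
  qed
  show "-pi \<le> Inf I" "Sup I \<le> pi"
    using I by (auto intro!: cInf_greatest cSup_least)
  show "Inf I \<le> Sup I" using sub I(2) by force
qed

text \<open>Along the arc dw/w = i dt, so the integrand in the path parameter is constant.\<close>

lemma arc_weight:
  assumes "lam > 0"
  shows "Re (1 / (2 * of_real pi * \<i>) * contour_integral (arc lam I) (\<lambda>w. 1 / w))
       = (Sup I - Inf I) / (2 * pi)"
proof -
  have "contour_integral (arc lam I) (\<lambda>w. 1 / w)
      = integral {0..1} (\<lambda>x::real. \<i> * of_real (Sup I - Inf I))"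
    unfolding contour_integral_integral arc_def vector_derivative_part_circlepath
    using assms by (intro integral_cong) (simp add: part_circlepath_def)
  thus ?thesis by simp
qed

lemma borel_set_arg_interval: "I \<in> arg_intervals \<Longrightarrow> I \<in> sets borel"
  unfolding arg_intervals_def by (auto intro: real_interval_borel_measurable)

lemma emeasure_angle_measure_interval:
  assumes "I \<in> arg_intervals"
  shows "emeasure angle_measure I = ennreal ((Sup I - Inf I) / (2 * pi))"
proof -
  note s = bounded_interval_sandwich[OF assms]
  note [measurable] = borel_set_arg_interval[OF assms]
  have "emeasure lborel {Inf I<..<Sup I} \<le> emeasure lborel (I \<inter> {-pi<..pi})"
    using s by (intro emeasure_mono) (force simp: subset_eq)+
  moreover have "emeasure lborel (I \<inter> {-pi<..pi}) \<le> emeasure lborel {Inf I..Sup I}"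
    using s by (intro emeasure_mono) auto
  ultimately have "emeasure lborel (I \<inter> {-pi<..pi}) = ennreal (Sup I - Inf I)"
    using s by simp
  thus ?thesis
    using s by (simp add: emeasure_angle_measure divide_ennreal)
qed

section \<open>The sector sigma-algebra and the measure on it\<close>

lemma sector_image_subset: "sector lam ` arg_intervals \<subseteq> Pow (cball 0 lam)"
  by (auto simp: sector_def)

lemma space_exterior_prob1 [simp]: "space (exterior_prob1 lam) = cball 0 lam"
  unfolding exterior_prob1_def by (rule space_extend_measure[OF sector_image_subset])

lemma sets_exterior_prob1: "sets (exterior_prob1 lam) = sigma_sets (cball 0 lam) (sector lam ` arg_intervals)"
  unfolding exterior_prob1_def by (rule sets_extend_measure[OF sector_image_subset])

lemma sector_vimage_cis:
  assumes "lam > 0"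
  shows "(\<lambda>t. of_real lam * cis t) -` sector lam I = (\<lambda>t. Arg (of_real lam * cis t)) -` I"
  using assms by (auto simp: sector_def norm_mult)

lemma measurable_scaled_cis:
  assumes "lam > 0"
  shows "(\<lambda>t. of_real lam * cis t) \<in> measurable angle_measure (exterior_prob1 lam)"
proof (rule measurable_sigma_sets[OF sets_exterior_prob1 sector_image_subset])
  show "(\<lambda>t. of_real lam * cis t) \<in> space angle_measure \<rightarrow> cball 0 lam"
    using assms by (auto simp: norm_mult)
  fix A assume "A \<in> sector lam ` arg_intervals"
  then obtain I where I: "I \<in> arg_intervals" "A = sector lam I" by auto
  note [measurable] = borel_set_arg_interval[OF I(1)]
  have "(\<lambda>t. Arg (of_real lam * cis t)) -` I \<inter> space borel \<in> sets borel"
    by measurable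
  thus "(\<lambda>t. of_real lam * cis t) -` A \<inter> space angle_measure \<in> sets angle_measure"
    by (simp add: I sector_vimage_cis[OF assms])
qed

lemma emeasure_distr_sector:
  assumes "lam > 0" "I \<in> arg_intervals"
  shows "emeasure (distr angle_measure (exterior_prob1 lam) (\<lambda>t. of_real lam * cis t)) (sector lam I)
       = ennreal ((Sup I - Inf I) / (2 * pi))"
proof -
  note [measurable] = borel_set_arg_interval[OF assms(2)]
  have "sector lam I \<in> sets (exterior_prob1 lam)"
    using assms by (auto simp: sets_exterior_prob1)
  hence "emeasure (distr angle_measure (exterior_prob1 lam) (\<lambda>t. of_real lam * cis t)) (sector lam I)
      = emeasure angle_measure ((\<lambda>t. Arg (of_real lam * cis t)) -` I)"
    by (simp add: emeasure_distr measurable_scaled_cis assms sector_vimage_cis)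
  also have "\<dots> = emeasure angle_measure I"
  proof -
    have "(\<lambda>t. Arg (of_real lam * cis t)) -` I \<inter> space borel \<in> sets borel"
      by measurable
    \<comment> \<open>The preimage is 2 pi periodic and so differs from \<open>I\<close> elsewhere,
      but \<open>angle_measure\<close> sees only this interval.\<close>
    moreover have "(\<lambda>t. Arg (of_real lam * cis t)) -` I \<inter> {-pi<..pi} = I \<inter> {-pi<..pi}"
      using Arg_scaled_cis[OF assms(1)] by auto
    ultimately show ?thesis by (simp add: emeasure_angle_measure)
  qed
  finally show ?thesis by (simp add: emeasure_angle_measure_interval assms)
qed

lemma sector_Int: "sector lam I \<inter> sector lam J = sector lam (I \<inter> J)"
  by (auto simp: sector_def)

text \<open>\<open>Arg\<close> never takes the value \<open>-\<pi>\<close>, so the empty set is itself a sector and the sectors are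
  stable under intersection.\<close>

lemma sector_singleton_mpi: "sector lam {-pi} = {}"
  by (simp add: sector_def mpi_less_Arg[THEN less_imp_neq, THEN not_sym])

lemma Int_stable_sectors: "Int_stable (sector lam ` arg_intervals)"
proof (rule Int_stableI_image)
  fix I J assume IJ: "I \<in> arg_intervals" "J \<in> arg_intervals"
  show "\<exists>K\<in>arg_intervals. sector lam I \<inter> sector lam J = sector lam K"
  proof (cases "I \<inter> J = {}")
    case True
    have "{-pi} \<in> arg_intervals" by (auto simp: arg_intervals_def is_interval_1)
    moreover have "sector lam I \<inter> sector lam J = {}"
      using True by (auto simp: sector_def)
    ultimately show ?thesis using sector_singleton_mpi by blast
  next
    case False
    thus ?thesis using IJ
      by (intro bexI[of _ "I \<inter> J"]) (auto simp: sector_Int arg_intervals_def is_interval_Int)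
  qed
qed

text \<open>The pushforward witnesses that the prescribed weights extend to a measure, so
  \<open>exterior_prob1\<close> really has them. Both measures then agree on an intersection-stable
  generator, hence everywhere. There is no circularity: the target of \<open>distr\<close>
  contributes only its sigma-algebra.\<close>

lemma exterior_prob1_eq_distr:
  assumes "lam > 0"
  shows "exterior_prob1 lam = distr angle_measure (exterior_prob1 lam) (\<lambda>t. of_real lam * cis t)"
    (is "?M = ?D")
proof (rule measure_eqI_generator_eq[where E = "sector lam ` arg_intervals" and \<Omega> = "cball 0 lam"
      and A = "\<lambda>_. cball 0 lam"])
  have eq: "emeasure ?M (sector lam I) = ennreal ((Sup I - Inf I) / (2 * pi))"
    if "I \<in> arg_intervals" for I
  proof (subst emeasure_extend_measure[OF exterior_prob1_def, where \<mu>' = "emeasure ?D" and i = I])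
    show "emeasure ?D (sector lam I)
        = ennreal (Re (1 / (2 * of_real pi * \<i>) * contour_integral (arc lam I) (\<lambda>w. 1 / w)))"
      if "I \<in> arg_intervals" for I
      using that assms by (simp only: arc_weight emeasure_distr_sector)
    show "positive (sets ?M) (emeasure ?D)"
      using emeasure_positive[of ?D] by simp
    show "countably_additive (sets ?M) (emeasure ?D)"
      using emeasure_countably_additive[of ?D] by simp
  qed (use that assms in \<open>simp_all only: arc_weight sector_image_subset\<close>)
  show "emeasure ?M X = emeasure ?D X" if "X \<in> sector lam ` arg_intervals" for X
    using that eq emeasure_distr_sector[OF assms] by auto
  \<comment> \<open>Every argument lies in \<open>{-pi..pi}\<close>, so the whole disc is a sector
    of finite measure and a constant sequence exhausts the space.\<close>
  have full: "{-pi..pi} \<in> arg_intervals" "cball 0 lam = sector lam {-pi..pi}"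
    using mpi_less_Arg Arg_le_pi by (auto simp: arg_intervals_def sector_def less_imp_le)
  thus "range (\<lambda>_. cball 0 lam) \<subseteq> sector lam ` arg_intervals" by auto
  show "emeasure ?M (cball 0 lam) \<noteq> \<infinity>"
    using eq[OF full(1)] full(2) by simp
qed (simp_all add: Int_stable_sectors sector_image_subset sets_exterior_prob1)

lemma prob_space_exterior_prob1:
  assumes "lam > 0" shows "prob_space (exterior_prob1 lam)"
  by (subst exterior_prob1_eq_distr[OF assms])
    (rule prob_space.prob_space_distr[OF prob_space_angle_measure measurable_scaled_cis[OF assms]])

text \<open>A sublevel set is a sector, with the bound capped at pi to keep the interval admissible,
  or it is empty when the bound lies below -pi. Measurability of the radial projection and of the
  characters rests on this.\<close>

lemma Arg_measurable_exterior_prob1: "Arg \<in> borel_measurable (exterior_prob1 lam)"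
proof (rule borel_measurableI_le)
  fix y :: real
  show "{w \<in> space (exterior_prob1 lam). Arg w \<le> y} \<in> sets (exterior_prob1 lam)"
  proof (cases "-pi \<le> y")
    case True
    have "{w \<in> space (exterior_prob1 lam). Arg w \<le> y} = sector lam {-pi..min pi y}"
      using mpi_less_Arg Arg_le_pi by (auto simp: sector_def less_imp_le)
    moreover have "{-pi..min pi y} \<in> arg_intervals"
      using True by (auto simp: arg_intervals_def)
    ultimately show ?thesis by (auto simp: sets_exterior_prob1)
  next
    case False
    hence "\<not> Arg w \<le> y" for w
      using mpi_less_Arg[of w] by linarith
    hence "{w \<in> space (exterior_prob1 lam). Arg w \<le> y} = {}"
      by blast
    thus ?thesis by (simp only: sets.empty_sets)
  qed
qed

section \<open>Integrals over a single circle\<close>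

lemma radial_proj_measurable [measurable]: "radial_proj lam \<in> borel_measurable (exterior_prob1 lam')"
  unfolding radial_proj_def using Arg_measurable_exterior_prob1[measurable] by measurable

lemma integral_exterior_prob1:
  fixes h :: "complex \<Rightarrow> complex"
  assumes "lam > 0" "(\<lambda>z. h (radial_proj lam z)) \<in> borel_measurable borel"
    and bound: "\<And>z. norm (h (radial_proj lam z)) \<le> B"
  shows "(LINT z|exterior_prob1 lam. h (radial_proj lam z))
       = integral {-pi..pi} (\<lambda>t. h (of_real lam * cis t)) / (2 * pi)"
proof -
  have h: "h (of_real lam * cis t) = h (radial_proj lam (of_real lam * cis t))" for t
    by (simp add: radial_proj_scaled_cis assms)
  \<comment> \<open>The assumption concerns the Borel algebra, which is finer than the sector one.
    As \<open>radial_proj\<close> is idempotent, the function equals its own composite with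
    \<open>radial_proj\<close>, and that projection is sector-measurable.\<close>
  have meas: "(\<lambda>z. h (radial_proj lam z)) \<in> borel_measurable (exterior_prob1 lam)"
    using measurable_compose[OF radial_proj_measurable assms(2), of lam lam]
    by (simp add: radial_proj_idem assms(1))
  have "(LINT z|exterior_prob1 lam. h (radial_proj lam z))
      = (LINT t|angle_measure. h (of_real lam * cis t))"
    using integral_distr[OF measurable_scaled_cis[OF \<open>lam > 0\<close>] meas] assms
    by (simp flip: exterior_prob1_eq_distr add: radial_proj_scaled_cis)
  also have "\<dots> = integral {-pi..pi} (\<lambda>t. h (of_real lam * cis t)) / (2 * pi)"
  proof (rule integral_angle_measure)
    show "(\<lambda>t. h (of_real lam * cis t)) \<in> borel_measurable borel"
      unfolding h by (rule measurable_compose[OF _ assms(2)]) measurable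
    show "norm (h (of_real lam * cis t)) \<le> B" for t
      unfolding h by (rule bound)
  qed
  finally show ?thesis .
qed

text \<open>Reconciles two parametrisations: \<open>circlepath\<close> runs through
  \<open>{0..2 * pi}\<close>, the principal argument through \<open>{-pi..pi}\<close>.\<close>

lemma integral_periodic_shift:
  fixes G :: "real \<Rightarrow> complex"
  assumes [measurable]: "G \<in> borel_measurable borel" and bound: "\<And>t. norm (G t) \<le> B"
    and periodic: "\<And>t. G (t + 2 * pi) = G t"
  shows "integral {0..2 * pi} G = integral {-pi..pi} G"
proof -
  have int: "G integrable_on {a..b}" for a b
    by (intro set_borel_integral_eq_integral(1))
      (auto simp: set_integrable_def emeasure_lborel_Icc_eq intro!: integrableI_bounded_set_indicator[where B = B] bound)
  have "G \<circ> (+) (2 * pi) = G"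
    using periodic by (auto simp: add.commute)
  hence shift: "integral {-pi..0} G = integral {pi..2 * pi} G"
    using integral_shift_Icc_real[of "-pi" 0 G "2 * pi"] by simp
  have "integral {0..2 * pi} G = integral {0..pi} G + integral {pi..2 * pi} G"
    by (intro Henstock_Kurzweil_Integration.integral_combine[symmetric] int) auto
  also have "\<dots> = integral {-pi..0} G + integral {0..pi} G"
    by (simp add: shift)
  also have "\<dots> = integral {-pi..pi} G"
    by (intro Henstock_Kurzweil_Integration.integral_combine int) auto
  finally show ?thesis .
qed

text \<open>On the circle dz = i z dt, which produces the factor 2 pi i and the extra factor
  \<open>z\<close> under the mean. Measurability and a bound are asked instead of continuity because
  the inner integrals of an iterated contour integral are only shown to have these.\<close>

lemma contour_integral_circle:
  fixes h :: "complex \<Rightarrow> complex"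
  assumes lam: "lam > 0" and meas: "(\<lambda>z. h (radial_proj lam z)) \<in> borel_measurable borel"
    and bound: "\<And>z. norm (h (radial_proj lam z)) \<le> B"
  shows "contour_integral (circlepath 0 lam) h
       = 2 * pi * \<i> * (LINT z|exterior_prob1 lam. radial_proj lam z * h (radial_proj lam z))"
proof -
  define G where "G = (\<lambda>t::real. of_real lam * cis t * h (of_real lam * cis t))"
  have h: "h (of_real lam * cis t) = h (radial_proj lam (of_real lam * cis t))" for t
    by (simp add: radial_proj_scaled_cis lam)
  have "(\<lambda>t::real. h (of_real lam * cis t)) \<in> borel_measurable borel"
    unfolding h by (rule measurable_compose[OF _ meas]) measurable
  hence G_meas: "G \<in> borel_measurable borel"
    unfolding G_def by measurable
  have G_bound: "norm (G t) \<le> lam * B" for t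
    unfolding G_def h using bound lam by (simp add: norm_mult mult_left_mono)
  have G_periodic: "G (t + 2 * pi) = G t" for t
    by (simp add: G_def flip: cis_mult)
  have "contour_integral (circlepath 0 lam) h = integral {0..2 * pi} (\<lambda>t. \<i> * G t)"
    unfolding circlepath_def
    by (subst contour_integral_part_circlepath_eq) (auto simp: G_def mult_ac)
  also have "\<dots> = \<i> * integral {-pi..pi} G"
    using integral_periodic_shift[OF G_meas G_bound G_periodic] by simp
  also have "integral {-pi..pi} G
      = 2 * pi * (LINT z|exterior_prob1 lam. radial_proj lam z * h (radial_proj lam z))"
    using integral_exterior_prob1[of lam "\<lambda>z. z * h z" "lam * B"] lam meas bound
    by (simp add: G_def norm_mult mult_left_mono)
  finally show ?thesis by (simp add: mult_ac)
qed

section \<open>Iterated contour integrals over the torus\<close>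

lemma borel_measurable_vec_lambda:
  fixes g :: "'a \<Rightarrow> 'i::finite \<Rightarrow> 'b::euclidean_space"
  assumes "\<And>i. (\<lambda>x. g x i) \<in> borel_measurable M"
  shows "(\<lambda>x. \<chi> i. g x i) \<in> borel_measurable M"
  using assms
  by (auto simp: borel_measurable_euclidean_space[where f = "\<lambda>x. \<chi> i. g x i"] Basis_vec_def inner_axis
      intro!: borel_measurable_inner)

text \<open>The product measure is the pushforward of a pair measure under \<open>x(i := z)\<close>,
  so Fubini applies. The new coordinate is integrated last, just as the head of the list is the
  outermost contour in \<open>iterated_contour\<close>.\<close>

lemma (in product_prob_space) PiM_integral_insert:
  fixes f :: "_ \<Rightarrow> _::{banach, second_countable_topology}"
  assumes f: "integrable (Pi\<^sub>M (insert i J) M) f"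
  shows "integral\<^sup>L (Pi\<^sub>M (insert i J) M) f = (\<integral>z. (\<integral>x. f (x(i := z)) \<partial>Pi\<^sub>M J M) \<partial>M i)"
proof -
  interpret S: prob_space "Pi\<^sub>M J M" by (intro prob_space_PiM prob_space)
  interpret MS: pair_sigma_finite "M i" "Pi\<^sub>M J M" ..
  let ?D = "distr (M i \<Otimes>\<^sub>M Pi\<^sub>M J M) (Pi\<^sub>M (insert i J) M) (\<lambda>(z, x). x(i := z))"
  have D: "?D = Pi\<^sub>M (insert i J) M"
    by (rule distr_pair_PiM_eq_PiM) (rule prob_space)+
  have meas: "(\<lambda>(z, x). x(i := z)) \<in> measurable (M i \<Otimes>\<^sub>M Pi\<^sub>M J M) (Pi\<^sub>M (insert i J) M)"
    by measurable
  have int: "integrable (M i \<Otimes>\<^sub>M Pi\<^sub>M J M) (\<lambda>p. f (case p of (z, x) \<Rightarrow> x(i := z)))"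
    by (rule integrable_distr[OF meas]) (simp add: D f)
  have "integral\<^sup>L (Pi\<^sub>M (insert i J) M) f = integral\<^sup>L ?D f"
    by (simp only: D)
  also have "\<dots> = (\<integral>p. f (case p of (z, x) \<Rightarrow> x(i := z)) \<partial>(M i \<Otimes>\<^sub>M Pi\<^sub>M J M))"
    by (rule integral_distr[OF meas]) (use f in auto)
  also have "\<dots> = (\<integral>z. (\<integral>x. f (x(i := z)) \<partial>Pi\<^sub>M J M) \<partial>M i)"
    using MS.integral_fst'[OF int] by simp
  finally show ?thesis .
qed

definition torus :: "real \<Rightarrow> (complex ^ 'n) set" where
  "torus lam = {w. \<forall>\<alpha>. norm (w $ \<alpha>) = lam}"

lemma torus_component_nonzero: "w \<in> torus lam \<Longrightarrow> lam > 0 \<Longrightarrow> w $ \<beta> \<noteq> 0"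
  by (auto simp: torus_def)

lemma closed_torus: "closed (torus lam)"
  unfolding torus_def by (intro closed_Collect_all closed_Collect_eq continuous_intros)

lemma compact_torus: "compact (torus lam :: (complex ^ 'n) set)"
proof -
  have "norm w \<le> real CARD('n) * lam" if "w \<in> torus lam" for w :: "complex ^ 'n"
    using L2_set_le_sum[of UNIV "\<lambda>\<alpha>. norm (w $ \<alpha>)"] that by (simp add: norm_vec_def torus_def)
  hence "bounded (torus lam :: (complex ^ 'n) set)" by (auto simp: bounded_iff)
  thus ?thesis using closed_torus by (auto simp: compact_eq_bounded_closed)
qed

lemma radial_proj_component_measurable:
  assumes "i \<in> I"
  shows "(\<lambda>x. radial_proj lam (x i)) \<in> borel_measurable (Pi\<^sub>M I (\<lambda>_. exterior_prob1 lam'))"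
  by (rule measurable_compose[OF _ radial_proj_measurable])
    (rule measurable_component_singleton[OF assms])

text \<open>Each contour contributes 2 pi i and one factor of the variable, by
  \<open>contour_integral_circle\<close>. Coordinates outside the list stay frozen at modulus
  \<open>lam\<close>, so that \<open>F\<close> is always evaluated on the torus. Off the torus
  \<open>F\<close> is arbitrary; the Borel function \<open>g\<close> supplies the
  measurability.\<close>

lemma iterated_contour_eq_integral:
  fixes F g :: "complex ^ 'n \<Rightarrow> complex" and w :: "complex ^ 'n"
  assumes lam: "lam > 0" and g [measurable]: "g \<in> borel_measurable borel"
    and Fg: "\<And>w. w \<in> torus lam \<Longrightarrow> F w = g w" and B: "\<And>w. w \<in> torus lam \<Longrightarrow> norm (F w) \<le> B"
    and "distinct bs" "\<And>\<alpha>. \<alpha> \<notin> set bs \<Longrightarrow> norm (w $ \<alpha>) = lam"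
  shows "iterated_contour lam bs F w = (2 * pi * \<i>) ^ length bs *
    (LINT x|Pi\<^sub>M (set bs) (\<lambda>_. exterior_prob1 lam).
      (\<Prod>b\<in>set bs. radial_proj lam (x b)) *
      F (\<chi> \<alpha>. if \<alpha> \<in> set bs then radial_proj lam (x \<alpha>) else w $ \<alpha>))"
  using assms(5,6)
proof (induction bs arbitrary: w)
  case Nil
  interpret prob_space "Pi\<^sub>M {} (\<lambda>_::'n. exterior_prob1 lam)"
    by (intro prob_space_PiM prob_space_exterior_prob1 lam)
  show ?case by (simp add: prob_space)
next
  case (Cons b bs)
  let ?N = "exterior_prob1 lam" and ?rp = "radial_proj lam"
  interpret prob_space ?N by (rule prob_space_exterior_prob1[OF lam])
  interpret product_prob_space "\<lambda>_::'n. ?N" by standard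
  let ?P = "Pi\<^sub>M (set bs) (\<lambda>_. ?N)" and ?Q = "Pi\<^sub>M (insert b (set bs)) (\<lambda>_. ?N)"
  interpret PB: prob_space ?P by (intro prob_space_PiM prob_space_exterior_prob1 lam)
  interpret QB: prob_space ?Q by (intro prob_space_PiM prob_space_exterior_prob1 lam)
  \<comment> \<open>With the head variable at \<open>z\<close>, the inner integrals run over
    \<open>K x z\<close>, which is \<open>F\<close> at the point \<open>p x z\<close> times the
    factors already produced. Each of these factors has modulus \<open>lam\<close>, whence the bound
    \<open>C\<close>.\<close>
  define W where "W z = (\<chi> \<alpha>. if \<alpha> = b then z else w $ \<alpha>)" for z
  define p where "p x z = (\<chi> \<alpha>. if \<alpha> \<in> set bs then ?rp (x \<alpha>) else W z $ \<alpha>)" for x z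
  define K where "K x z = (\<Prod>b\<in>set bs. ?rp (x b)) * F (p x z)" for x z
  define H where "H z = iterated_contour lam bs F (W z)" for z
  define C where "C = lam ^ card (set bs) * B"
  have b: "b \<notin> set bs" "distinct bs" using Cons.prems(1) by auto
  have p_torus: "p x (?rp z) \<in> torus lam" for x z
    using Cons.prems(2) lam by (auto simp: torus_def p_def W_def)
  have K_bound: "norm (K x (?rp z)) \<le> C" for x z
    using B[OF p_torus, of x z] lam
    by (simp add: K_def C_def norm_mult prod_norm[symmetric] mult_left_mono)
  have K_g: "K x (?rp z) = (\<Prod>b\<in>set bs. ?rp (x b)) * g (p x (?rp z))" for x z
    by (simp add: K_def Fg p_torus)
  \<comment> \<open>The outer variable carries the Borel algebra because
    \<open>contour_integral_circle\<close> wants \<open>H\<close> Borel measurable along the circle;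
    this will follow by integrating the jointly measurable \<open>K\<close> over
    \<open>x\<close>.\<close>
  have p_meas: "(\<lambda>(z, x). p x (?rp z)) \<in> borel_measurable (borel \<Otimes>\<^sub>M ?P)"
    unfolding p_def W_def case_prod_unfold vec_lambda_beta
  proof (rule borel_measurable_vec_lambda)
    fix \<alpha>
    show "(\<lambda>q. if \<alpha> \<in> set bs then ?rp (snd q \<alpha>) else if \<alpha> = b then ?rp (fst q) else w $ \<alpha>)
        \<in> borel_measurable (borel \<Otimes>\<^sub>M ?P)"
    proof (cases "\<alpha> \<in> set bs")
      case True
      thus ?thesis
        using measurable_compose[OF measurable_snd radial_proj_component_measurable[OF True]] by simp
    next
      case False
      thus ?thesis
        using measurable_compose[OF measurable_fst borel_measurable_radial_proj]
        by (cases "\<alpha> = b") (simp_all only: simp_thms if_False if_True measurable_const UNIV_I space_borel)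
    qed
  qed
  have K_meas: "(\<lambda>(z, x). K x (?rp z)) \<in> borel_measurable (borel \<Otimes>\<^sub>M ?P)"
  proof -
    have prod: "(\<lambda>x. \<Prod>b\<in>set bs. ?rp (x b)) \<in> borel_measurable ?P"
      by (intro borel_measurable_prod radial_proj_component_measurable)
    show ?thesis
      unfolding K_g case_prod_unfold
      using measurable_compose[OF measurable_snd prod, of borel] measurable_compose[OF p_meas g]
      by (intro borel_measurable_times) (simp_all only: case_prod_unfold)
  qed
  have H: "H (?rp z) = (2 * pi * \<i>) ^ length bs * (LINT x|?P. K x (?rp z))" for z
    unfolding H_def K_def p_def
    by (rule Cons.IH[OF b(2)]) (use Cons.prems(2) lam in \<open>auto simp: W_def\<close>)
  have H_meas: "(\<lambda>z. H (?rp z)) \<in> borel_measurable borel"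
    unfolding H
    by (intro borel_measurable_times borel_measurable_const PB.borel_measurable_lebesgue_integral K_meas)
  have K_int: "norm (LINT x|?P. K x (?rp z)) \<le> C" for z
  proof -
    have [measurable]: "(\<lambda>x. K x (?rp z)) \<in> borel_measurable ?P"
      using measurable_compose[OF measurable_Pair1'[of z borel] K_meas] by (simp only: case_prod_conv space_borel UNIV_I)
    have "integrable ?P (\<lambda>x. K x (?rp z))"
      by (rule PB.integrable_const_bound[where B = C]) (auto simp: K_bound)
    hence "(LINT x|?P. norm (K x (?rp z))) \<le> C"
      by (intro PB.integral_le_const) (auto simp: K_bound)
    thus ?thesis by (rule order_trans[OF integral_norm_bound])
  qed
  have H_bound: "norm (H (?rp z)) \<le> (2 * pi) ^ length bs * C" for z
    unfolding H using K_int[of z] by (simp add: norm_mult norm_power mult_left_mono)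
  define R where "R x = (\<Prod>b\<in>insert b (set bs). ?rp (x b)) *
      F (\<chi> \<alpha>. if \<alpha> \<in> insert b (set bs) then ?rp (x \<alpha>) else w $ \<alpha>)" for x
  have R_K: "R x = ?rp (x b) * K x (?rp (x b))" for x
    using b by (auto simp: R_def K_def p_def W_def intro!: arg_cong[where f = F] simp: vec_eq_iff)
  have R_int: "integrable ?Q R"
  proof (rule QB.integrable_const_bound[where B = "lam * C"])
    show "AE x in ?Q. norm (R x) \<le> lam * C"
      unfolding R_K using K_bound lam by (auto simp: norm_mult intro!: mult_left_mono)
    have "(\<lambda>x. p x (?rp (x b))) \<in> borel_measurable ?Q"
      unfolding p_def W_def vec_lambda_beta
    proof (rule borel_measurable_vec_lambda)
      fix \<alpha>
      show "(\<lambda>x. if \<alpha> \<in> set bs then ?rp (x \<alpha>) else if \<alpha> = b then ?rp (x b) else w $ \<alpha>)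
          \<in> borel_measurable ?Q"
        using radial_proj_component_measurable[of \<alpha> "insert b (set bs)" lam lam]
        by (cases "\<alpha> \<in> set bs"; cases "\<alpha> = b") simp_all
    qed
    from measurable_compose[OF this g] show "R \<in> borel_measurable ?Q"
      unfolding R_K K_g
      by (intro borel_measurable_times borel_measurable_prod radial_proj_component_measurable) auto
  qed
  \<comment> \<open>\<open>K\<close> reads only the coordinates in \<open>set bs\<close>, so
    overwriting coordinate \<open>b\<close> changes only the factor and the outer argument that
    \<open>R_K\<close> exhibits.\<close>
  have K_upd: "K (x(b := z)) = K x" for x z
    using b by (auto simp: K_def p_def fun_eq_iff vec_eq_iff intro!: prod.cong arg_cong2[where f = "(*)"] arg_cong[where f = F])
  have "iterated_contour lam (b # bs) F w = contour_integral (circlepath 0 lam) H"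
    by (simp add: H_def[abs_def] W_def)
  also have "\<dots> = 2 * pi * \<i> * (LINT z|?N. ?rp z * H (?rp z))"
    by (rule contour_integral_circle[OF lam H_meas H_bound])
  also have "(LINT z|?N. ?rp z * H (?rp z))
      = (2 * pi * \<i>) ^ length bs * (LINT z|?N. LINT x|?P. R (x(b := z)))"
    unfolding R_K K_upd H
    by (simp add: mult.left_commute[of "?rp _" "(2 * complex_of_real pi * \<i>) ^ length bs"])
  also have "(LINT z|?N. LINT x|?P. R (x(b := z))) = integral\<^sup>L ?Q R"
    by (rule PiM_integral_insert[OF R_int, symmetric])
  finally show ?case by (simp add: R_def[abs_def])
qed

text \<open>The integral on the right is symmetric in the coordinates, so the enumeration chosen by
  \<open>SOME\<close> drops out.\<close>

lemma torus_integral_eq: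
  fixes F :: "complex ^ 'n \<Rightarrow> complex"
  assumes lam: "lam > 0" and cont: "continuous_on (torus lam) F"
  shows "torus_integral lam F = (2 * pi * \<i>) ^ CARD('n) *
    (LINT x|Pi\<^sub>M UNIV (\<lambda>_. exterior_prob1 lam).
      (\<Prod>b\<in>UNIV. radial_proj lam (x b)) * F (\<chi> \<alpha>. radial_proj lam (x \<alpha>)))"
proof -
  define bs where "bs = (SOME bs. distinct bs \<and> set bs = (UNIV :: 'n set))"
  have "\<exists>bs. distinct bs \<and> set bs = (UNIV :: 'n set)"
    using finite_distinct_list[of "UNIV :: 'n set"] by auto
  hence bs: "distinct bs" "set bs = UNIV"
    using someI_ex[of "\<lambda>bs. distinct bs \<and> set bs = (UNIV :: 'n set)"] by (auto simp: bs_def)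
  have "compact (F ` torus lam)"
    using cont compact_torus by (rule compact_continuous_image)
  then obtain B where "\<forall>w\<in>torus lam. norm (F w) \<le> B"
    by (auto dest!: compact_imp_bounded simp: bounded_iff)
  \<comment> \<open>The Borel function agreeing with \<open>F\<close> on the torus is its extension
    by zero; it is Borel because the torus is closed.\<close>
  moreover have "(\<lambda>w. indicator (torus lam) w *\<^sub>R F w) \<in> borel_measurable borel"
    by (intro borel_measurable_continuous_on_indicator cont borel_closed closed_torus)
  moreover have "length bs = CARD('n)"
    using distinct_card[OF bs(1)] bs(2) by simp
  ultimately show ?thesis
    using iterated_contour_eq_integral[OF lam, of "\<lambda>w. indicator (torus lam) w *\<^sub>R F w" F B bs 0] bs
    by (simp add: torus_integral_def bs_def[symmetric])
qed

section \<open>Continuity of analytic functions\<close>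

lemma open_polydisc: "open (polydisc z R)"
proof -
  have "polydisc z R = (\<Inter>\<beta>\<in>UNIV. {w. norm (w $ \<beta> - z $ \<beta>) < R})"
    by (auto simp: polydisc_def)
  also have "open \<dots>"
    by (intro open_INT ballI open_Collect_less continuous_intros) auto
  finally show ?thesis .
qed

text \<open>Absolute convergence at the point with all coordinates shifted by
  \<open>r = R / 2\<close> dominates the terms on the polydisc of radius \<open>r\<close>. By the
  Weierstrass M-test the sum is there a uniform limit of polynomials.\<close>

lemma isCont_power_series_on:
  fixes g :: "complex ^ 'n \<Rightarrow> complex" and z :: "complex ^ 'n"
  assumes "power_series_on g z R" "R > 0"
  shows "isCont g z"
proof -
  define r where "r = R / 2"
  have r: "0 < r" "r < R" using assms(2) by (auto simp: r_def)
  obtain a where a: "\<And>w. w \<in> polydisc z R \<Longrightarrow>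
      ((\<lambda>m. a m * (\<Prod>\<beta>\<in>UNIV. (w $ \<beta> - z $ \<beta>) ^ m \<beta>)) has_sum g w) UNIV"
    using assms(1) unfolding power_series_on_def by blast
  have "z + (\<chi> \<beta>. of_real r) \<in> polydisc z R"
    using r by (simp add: polydisc_def)
  from a[OF this] have "(\<lambda>m. a m * (\<Prod>\<beta>\<in>UNIV. of_real r ^ m \<beta>)) summable_on UNIV"
    unfolding summable_on_def by auto
  hence summable: "(\<lambda>m. norm (a m * (\<Prod>\<beta>\<in>UNIV. of_real r ^ m \<beta>))) summable_on UNIV"
    by (simp only: summable_on_iff_abs_summable_on_complex)
  have limit: "uniform_limit (polydisc z r)
      (\<lambda>S w. \<Sum>m\<in>S. a m * (\<Prod>\<beta>\<in>UNIV. (w $ \<beta> - z $ \<beta>) ^ m \<beta>))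
      (\<lambda>w. \<Sum>\<^sub>\<infinity>m\<in>UNIV. a m * (\<Prod>\<beta>\<in>UNIV. (w $ \<beta> - z $ \<beta>) ^ m \<beta>)) (finite_subsets_at_top UNIV)"
  proof (rule Weierstrass_m_test_general[OF _ summable])
    fix m :: "'n \<Rightarrow> nat" and w assume w: "w \<in> polydisc z r"
    have "(\<Prod>\<beta>\<in>UNIV. norm (w $ \<beta> - z $ \<beta>) ^ m \<beta>) \<le> (\<Prod>\<beta>\<in>UNIV. r ^ m \<beta>)"
      using w by (intro prod_mono) (auto simp: polydisc_def less_imp_le power_mono)
    thus "norm (a m * (\<Prod>\<beta>\<in>UNIV. (w $ \<beta> - z $ \<beta>) ^ m \<beta>)) \<le> norm (a m * (\<Prod>\<beta>\<in>UNIV. of_real r ^ m \<beta>))"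
      using r by (simp add: norm_mult prod_norm[symmetric] norm_power mult_left_mono)
  qed
  have partial_sums: "\<forall>\<^sub>F S in finite_subsets_at_top UNIV. continuous_on (polydisc z r)
      (\<lambda>w. \<Sum>m\<in>S. a m * (\<Prod>\<beta>\<in>UNIV. (w $ \<beta> - z $ \<beta>) ^ m \<beta>))"
    by (intro always_eventually allI continuous_intros)
  have "continuous_on (polydisc z r)
      (\<lambda>w. \<Sum>\<^sub>\<infinity>m\<in>UNIV. a m * (\<Prod>\<beta>\<in>UNIV. (w $ \<beta> - z $ \<beta>) ^ m \<beta>))"
    by (rule uniform_limit_theorem[OF partial_sums limit]) simp
  moreover have "(\<Sum>\<^sub>\<infinity>m\<in>UNIV. a m * (\<Prod>\<beta>\<in>UNIV. (w $ \<beta> - z $ \<beta>) ^ m \<beta>)) = g w"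
    if "w \<in> polydisc z r" for w
  proof (rule infsumI[OF a])
    show "w \<in> polydisc z R"
      using that r(2) by (auto simp: polydisc_def intro: less_trans)
  qed
  ultimately have "continuous_on (polydisc z r) g"
    by (rule continuous_on_eq)
  moreover have "z \<in> polydisc z r"
    using r(1) by (simp add: polydisc_def)
  ultimately show ?thesis
    by (simp only: continuous_on_eq_continuous_at[OF open_polydisc])
qed

text \<open>No coordinate vanishes on the torus, so \<open>f\<close> has a power series centred at
  each of its points, and continuity at the centre suffices.\<close>

lemma single_pole_at_0_continuous_on_torus:
  fixes f :: "complex ^ 'n \<Rightarrow> complex ^ 'k"
  assumes "single_pole_at_0 f" "lam > 0"
  shows "continuous_on (torus lam) (\<lambda>w. f w $ \<alpha>)"
proof (rule continuous_at_imp_continuous_on, rule ballI)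
  fix z :: "complex ^ 'n" assume "z \<in> torus lam"
  hence "\<forall>\<beta>. z $ \<beta> \<noteq> 0"
    using assms(2) by (simp add: torus_component_nonzero)
  thus "isCont (\<lambda>w. f w $ \<alpha>) z"
    using assms(1) isCont_power_series_on unfolding single_pole_at_0_def mv_analytic_at_def by blast
qed

section \<open>Characters and Bessel's inequality\<close>

text \<open>Let \<open>s\<close> be the orthogonal projection of \<open>h\<close> onto the span of
  the \<open>e i\<close>. The products of \<open>h\<close> with \<open>s\<close>, of
  \<open>s\<close> with \<open>h\<close> and of \<open>s\<close> with itself all integrate to the
  sum of the squared moduli of the coefficients, so expanding the nonnegative mean of |h - s|^2
  leaves the asserted difference.\<close>

lemma bessel_inequality:
  fixes e :: "'i \<Rightarrow> 'a \<Rightarrow> complex" and h :: "'a \<Rightarrow> complex"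
  assumes fin: "finite I"
    and hh: "integrable M (\<lambda>x. cnj (h x) * h x)"
    and eh: "\<And>i. i \<in> I \<Longrightarrow> integrable M (\<lambda>x. cnj (e i x) * h x)"
    and ee: "\<And>i j. i \<in> I \<Longrightarrow> j \<in> I \<Longrightarrow> integrable M (\<lambda>x. cnj (e i x) * e j x)"
    and orthonormal: "\<And>i j. i \<in> I \<Longrightarrow> j \<in> I \<Longrightarrow>
      (LINT x|M. cnj (e i x) * e j x) = (if i = j then 1 else 0)"
  shows "(\<Sum>i\<in>I. (norm (LINT x|M. cnj (e i x) * h x))\<^sup>2) \<le> Re (LINT x|M. cnj (h x) * h x)"
proof -
  define c where "c i = (LINT x|M. cnj (e i x) * h x)" for i
  define s where "s x = (\<Sum>i\<in>I. c i * e i x)" for x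
  have he: "integrable M (\<lambda>x. cnj (h x) * e i x)" if "i \<in> I" for i
    using integrable_cnj[OF eh[OF that]] by (simp add: mult.commute)
  have he_int: "(LINT x|M. cnj (h x) * e i x) = cnj (c i)" for i
    using Bochner_Integration.integral_cnj[of M "\<lambda>x. cnj (e i x) * h x"] by (simp add: c_def mult.commute)
  have sh: "integrable M (\<lambda>x. cnj (s x) * h x)"
    and sh_int: "(LINT x|M. cnj (s x) * h x) = (\<Sum>i\<in>I. cnj (c i) * c i)"
    using eh by (auto simp: s_def c_def sum_distrib_right mult.assoc)
  have hs: "integrable M (\<lambda>x. cnj (h x) * s x)"
    and hs_int: "(LINT x|M. cnj (h x) * s x) = (\<Sum>i\<in>I. cnj (c i) * c i)"
    using he he_int by (auto simp: s_def sum_distrib_left mult.left_commute mult.commute[of "c _" "cnj _"])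
  have es: "integrable M (\<lambda>x. cnj (e i x) * s x)"
    and es_int: "(LINT x|M. cnj (e i x) * s x) = c i" if "i \<in> I" for i
  proof -
    have eq: "cnj (e i x) * s x = (\<Sum>j\<in>I. c j * (cnj (e i x) * e j x))" for x
      by (simp add: s_def sum_distrib_left mult.left_commute)
    show "integrable M (\<lambda>x. cnj (e i x) * s x)"
      unfolding eq using ee[OF that] by auto
    have "(LINT x|M. cnj (e i x) * s x) = (\<Sum>j\<in>I. c j * (LINT x|M. cnj (e i x) * e j x))"
      unfolding eq using ee[OF that] by simp
    also have "\<dots> = (\<Sum>j\<in>I. if i = j then c j else 0)"
      using orthonormal[OF that] by (intro sum.cong) auto
    finally show "(LINT x|M. cnj (e i x) * s x) = c i"
      using that fin by simp
  qed
  have ss: "integrable M (\<lambda>x. cnj (s x) * s x)"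
    and ss_int: "(LINT x|M. cnj (s x) * s x) = (\<Sum>i\<in>I. cnj (c i) * c i)"
  proof -
    have eq: "cnj (s x) * s x = (\<Sum>i\<in>I. cnj (c i) * (cnj (e i x) * s x))" for x
      by (subst (1) s_def) (simp add: sum_distrib_right mult.assoc)
    show "integrable M (\<lambda>x. cnj (s x) * s x)" unfolding eq using es by auto
    show "(LINT x|M. cnj (s x) * s x) = (\<Sum>i\<in>I. cnj (c i) * c i)"
      unfolding eq using es es_int by simp
  qed
  have "0 \<le> (LINT x|M. (norm (h x - s x))\<^sup>2)"
    by simp
  also have "\<dots> = Re (LINT x|M. of_real ((norm (h x - s x))\<^sup>2))"
    by (subst integral_complex_of_real) simp
  also have "\<dots> = Re (LINT x|M. cnj (h x) * h x - cnj (h x) * s x - cnj (s x) * h x + cnj (s x) * s x)"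
    by (simp only: complex_norm_square) (simp add: algebra_simps)
  also have "\<dots> = Re ((LINT x|M. cnj (h x) * h x) - (\<Sum>i\<in>I. cnj (c i) * c i))"
    using hh hs sh ss by (simp add: hs_int sh_int ss_int)
  finally show ?thesis
    by (simp add: c_def cmod_power2 flip: power2_eq_square)
qed

text \<open>The Laurent monomial with exponents \<open>k\<close>, normalised to modulus 1. Writing
  it through \<open>Arg\<close> makes it measurable for the product of the sector sigma-algebras and
  independent of \<open>lam\<close>.\<close>

definition torus_character :: "('n \<Rightarrow> int) \<Rightarrow> ('n \<Rightarrow> complex) \<Rightarrow> complex" where
  "torus_character k x = (\<Prod>b\<in>UNIV. cis (Arg (x b)) powi k b)"

lemma norm_torus_character [simp]: "norm (torus_character k x) = 1"
  by (simp add: torus_character_def prod_norm[symmetric] norm_power_int)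

lemma borel_measurable_complex_power_int [measurable]:
  "(\<lambda>z::complex. z powi m) \<in> borel_measurable borel"
  unfolding power_int_def by measurable

lemma torus_character_measurable:
  fixes k :: "'n::finite \<Rightarrow> int"
  shows "torus_character k \<in> borel_measurable (Pi\<^sub>M UNIV (\<lambda>_. exterior_prob1 lam))"
proof -
  have "(\<lambda>x. Arg (x b)) \<in> borel_measurable (Pi\<^sub>M UNIV (\<lambda>_::'n. exterior_prob1 lam))" for b
    by (rule measurable_compose[OF _ Arg_measurable_exterior_prob1])
      (rule measurable_component_singleton, simp)
  thus ?thesis unfolding torus_character_def by measurable
qed

lemma integral_cis_multiple:
  assumes "m \<noteq> 0"
  shows "integral {-pi..pi} (\<lambda>t. cis (of_int m * t)) = 0"
proof -
  have "((\<lambda>t. cis (of_int m * t)) has_integral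
      (cis (of_int m * pi) / (\<i> * of_int m) - cis (of_int m * (-pi)) / (\<i> * of_int m))) {-pi..pi}"
  proof (rule fundamental_theorem_of_calculus)
    fix t :: real
    have "((\<lambda>z. exp (\<i> * of_int m * z) / (\<i> * of_int m)) has_field_derivative
        exp (\<i> * of_int m * of_real t)) (at (of_real t))"
      using assms by (auto intro!: derivative_eq_intros)
    from has_vector_derivative_real_field[OF this]
    show "((\<lambda>t. cis (of_int m * t) / (\<i> * of_int m)) has_vector_derivative cis (of_int m * t))
        (at t within {-pi..pi})"
      by (simp add: cis_conv_exp mult_ac)
  qed auto
  \<comment> \<open>The two angles differ by \<open>2 * pi * m\<close>, a multiple of the
    period.\<close>
  moreover have "cis (of_int m * pi) = cis (of_int m * (-pi))"
    by (simp add: complex_eq_iff sin_zero_iff_int2)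
  ultimately show ?thesis by (metis diff_self integral_unique)
qed

lemma integral_power_int_Arg:
  assumes "lam > 0"
  shows "(LINT z|exterior_prob1 lam. cis (Arg z) powi m) = (if m = 0 then 1 else 0)"
proof (cases "m = 0")
  case True
  thus ?thesis using prob_space.prob_space[OF prob_space_exterior_prob1[OF assms]] by simp
next
  case False
  \<comment> \<open>\<open>cis (Arg z)\<close> is rewritten as
    \<open>radial_proj lam z / lam\<close> to fit the shape required by
    \<open>integral_exterior_prob1\<close>.\<close>
  have "(LINT z|exterior_prob1 lam. (radial_proj lam z / of_real lam) powi m)
      = integral {-pi..pi} (\<lambda>t. (of_real lam * cis t / of_real lam) powi m) / (2 * pi)"
    using assms by (intro integral_exterior_prob1[where B = 1])
      (auto simp: norm_power_int norm_divide)
  thus ?thesis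
    using assms False by (simp add: radial_proj_def cis_power_int integral_cis_multiple)
qed

text \<open>The integral factorises over the coordinates. If \<open>k\<close> and \<open>l\<close>
  differ, some coordinate has a nonzero exponent, and its mean over the circle vanishes.\<close>

lemma torus_character_orthonormal:
  fixes k l :: "'n::finite \<Rightarrow> int"
  assumes lam: "lam > 0"
  shows "(LINT x|Pi\<^sub>M UNIV (\<lambda>_. exterior_prob1 lam). cnj (torus_character k x) * torus_character l x)
       = (if k = l then 1 else 0)"
proof -
  interpret N: prob_space "exterior_prob1 lam" by (rule prob_space_exterior_prob1[OF lam])
  interpret product_prob_space "\<lambda>_::'n. exterior_prob1 lam" by standard
  note [measurable] = Arg_measurable_exterior_prob1
  have int: "integrable (exterior_prob1 lam) (\<lambda>z. cis (Arg z) powi m)" for m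
    by (intro N.integrable_const_bound[where B = 1]) (auto simp: norm_power_int)
  have "cnj (torus_character k x) * torus_character l x = (\<Prod>b\<in>UNIV. cis (Arg (x b)) powi (l b - k b))" for x
    by (simp add: torus_character_def prod.distrib[symmetric] cis_power_int cis_cnj cis_mult
        algebra_simps)
  hence "(LINT x|Pi\<^sub>M UNIV (\<lambda>_. exterior_prob1 lam). cnj (torus_character k x) * torus_character l x)
      = (\<Prod>b\<in>UNIV. LINT z|exterior_prob1 lam. cis (Arg z) powi (l b - k b))"
    using product_integral_prod[of UNIV "\<lambda>b z. cis (Arg z) powi (l b - k b)"] int by simp
  also have "\<dots> = (\<Prod>b\<in>UNIV. if l b - k b = 0 then 1 else 0)"
    by (simp only: integral_power_int_Arg[OF lam])
  also have "\<dots> = (if k = l then 1 else 0)"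
    by (simp add: fun_eq_iff prod_zero_iff) metis
  finally show ?thesis .
qed

section \<open>Expectation and residues as Bessel coefficients\<close>

lemma integral_exterior_prob:
  fixes \<phi> :: "complex ^ 'n \<Rightarrow> 'b::{banach, second_countable_topology}"
  assumes "\<phi> \<in> borel_measurable (exterior_prob lam)"
  shows "integral\<^sup>L (exterior_prob lam) \<phi> = (LINT x|Pi\<^sub>M UNIV (\<lambda>_. exterior_prob1 lam). \<phi> (\<chi> \<alpha>. x \<alpha>))"
proof -
  have inj: "inj (vec_lambda :: ('n \<Rightarrow> complex) \<Rightarrow> _)"
    by (auto intro: injI simp: vec_lambda_inject)
  show ?thesis
    using assms integral_distr[OF measurable_embed_measure2[OF inj]] embed_measure_eq_distr[OF inj]
    unfolding exterior_prob_def by metis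
qed

text \<open>On the torus, the character with index \<open>bessel_index (Some \<beta>)\<close> is \<open>\<lambda> / w\<^sub>\<beta>\<close>.\<close>

definition bessel_index :: "'n option \<Rightarrow> 'n \<Rightarrow> int" where
  "bessel_index i b = (if i = Some b then -1 else 0)"

lemma bessel_index_inject: "bessel_index i = bessel_index j \<longleftrightarrow> i = j"
proof
  assume eq: "bessel_index i = bessel_index j"
  have "i = Some b \<longleftrightarrow> j = Some b" for b
    using fun_cong[OF eq, of b] by (simp add: bessel_index_def split: if_splits)
  thus "i = j" by (metis option.exhaust)
qed simp

lemma torus_character_bessel_index:
  fixes x :: "'n::finite \<Rightarrow> complex"
  shows "torus_character (bessel_index None) x = 1"
    and "cnj (torus_character (bessel_index (Some \<beta>)) x) = cis (Arg (x \<beta>))"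
proof -
  show "torus_character (bessel_index None) x = 1"
    by (simp add: torus_character_def bessel_index_def)
  have "torus_character (bessel_index (Some \<beta>)) x
      = (\<Prod>b\<in>UNIV. if b = \<beta> then cis (- Arg (x \<beta>)) else 1)"
    unfolding torus_character_def bessel_index_def
    by (intro prod.cong) (auto simp: cis_power_int)
  thus "cnj (torus_character (bessel_index (Some \<beta>)) x) = cis (Arg (x \<beta>))"
    by (simp add: cis_cnj)
qed

text \<open>The squared Frobenius norm, which is the form in which the squared Bessel coefficients
  add up.\<close>

lemma trace_conj_transpose:
  fixes A :: "complex ^ 'n ^ 'k"
  shows "Re (trace (conj_transpose A ** A)) = (\<Sum>\<alpha>\<in>UNIV. \<Sum>\<beta>\<in>UNIV. (norm (A $ \<alpha> $ \<beta>))\<^sup>2)"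
proof -
  have "Re (trace (conj_transpose A ** A)) = (\<Sum>\<beta>\<in>UNIV. \<Sum>\<alpha>\<in>UNIV. (norm (A $ \<alpha> $ \<beta>))\<^sup>2)"
    by (simp add: trace_def matrix_matrix_mult_def conj_transpose_def cmod_power2 flip: power2_eq_square)
  thus ?thesis by (simp add: sum.swap[of _ "UNIV :: 'n set"])
qed

text \<open>\<open>torus_integral_eq\<close> supplies the product of all coordinates. The
  denominator cancels all but coordinate \<beta>, and that one is \<open>lam\<close> times the
  conjugate of its character.\<close>

lemma residue_matrix_eq_character_coefficient:
  fixes f :: "complex ^ 'n \<Rightarrow> complex ^ 'k"
  assumes lam: "lam > 0" and cont: "continuous_on (torus lam) (\<lambda>w. f w $ \<alpha>)"
  shows "residue_matrix lam f $ \<alpha> $ \<beta> = lam * (LINT x|Pi\<^sub>M UNIV (\<lambda>_. exterior_prob1 lam).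
    cnj (torus_character (bessel_index (Some \<beta>)) x) * f (\<chi> \<alpha>. radial_proj lam (x \<alpha>)) $ \<alpha>)"
proof -
  let ?P = "Pi\<^sub>M UNIV (\<lambda>_::'n. exterior_prob1 lam)" and ?rp = "radial_proj lam"
  have rp_nz: "?rp z \<noteq> 0" for z
    using lam by (simp add: radial_proj_def)
  have "continuous_on (torus lam) (\<lambda>w. f w $ \<alpha> / (\<Prod>\<mu>\<in>UNIV - {\<beta>}. w $ \<mu>))"
    by (intro continuous_intros cont) (auto simp: torus_component_nonzero lam)
  note torus_integral_eq[OF lam this]
  moreover have "(\<Prod>b\<in>UNIV. ?rp (x b)) *
      (f (\<chi> \<alpha>. ?rp (x \<alpha>)) $ \<alpha> / (\<Prod>\<mu>\<in>UNIV - {\<beta>}. (\<chi> \<alpha>. ?rp (x \<alpha>)) $ \<mu>))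
    = lam * (cnj (torus_character (bessel_index (Some \<beta>)) x) * f (\<chi> \<alpha>. ?rp (x \<alpha>)) $ \<alpha>)" for x
    using rp_nz by (simp add: prod.remove[of UNIV \<beta>] torus_character_bessel_index)
      (simp add: radial_proj_def)
  ultimately have "torus_integral lam (\<lambda>w. f w $ \<alpha> / (\<Prod>\<mu>\<in>UNIV - {\<beta>}. w $ \<mu>))
    = (2 * pi * \<i>) ^ CARD('n) * (lam * (LINT x|?P.
        cnj (torus_character (bessel_index (Some \<beta>)) x) * f (\<chi> \<alpha>. ?rp (x \<alpha>)) $ \<alpha>))"
    by simp
  thus ?thesis by (simp add: residue_matrix_def)
qed

theorem mainTheorem3:
  fixes f :: "complex ^ 'n \<Rightarrow> complex ^ 'k"
    and \<eta> :: "complex ^ 'n ^ 'k"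
    and lam :: real
  assumes "lam > 0"
    and "f \<in> F_space lam"
    and "single_pole_at_0 f"
    and "\<eta> = residue_matrix lam f"
  shows "lam * std_error lam f \<ge> sqrt (Re (trace (conj_transpose \<eta> ** \<eta>)))"
proof -
  note lam = assms(1)
  let ?P = "Pi\<^sub>M UNIV (\<lambda>_::'n. exterior_prob1 lam)"
  let ?e = "\<lambda>i :: 'n option. torus_character (bessel_index i)"
  interpret P: prob_space ?P by (intro prob_space_PiM prob_space_exterior_prob1 lam)
  define u :: "('n \<Rightarrow> complex) \<Rightarrow> complex ^ 'n" where "u x = (\<chi> \<alpha>. radial_proj lam (x \<alpha>))" for x
  define h where "h \<alpha> x = f (u x) $ \<alpha>" for \<alpha> x
  have cont: "continuous_on (torus lam) (\<lambda>w. f w $ \<alpha>)" for \<alpha>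
    by (rule single_pole_at_0_continuous_on_torus[OF assms(3) lam])
  have u_torus: "u x \<in> torus lam" for x
    using lam by (simp add: u_def torus_def)
  have u_proj: "boundary_proj lam (\<chi> \<alpha>. x \<alpha>) = u x" for x
    by (simp add: boundary_proj_eq u_def)
  \<comment> \<open>Measurability comes from membership in \<open>F_space\<close>; it is carried
    over to the product space along \<open>vec_lambda\<close>.\<close>
  have f_meas: "(\<lambda>w. f (boundary_proj lam w)) \<in> borel_measurable (exterior_prob lam)"
    using assms(2) by (simp add: F_space_def exterior_measurable_def)
  have component_meas: "(\<lambda>v :: complex ^ 'k. v $ \<alpha>) \<in> borel_measurable borel" for \<alpha>
    by (intro borel_measurable_continuous_onI continuous_intros)
  have inj: "inj (vec_lambda :: ('n \<Rightarrow> complex) \<Rightarrow> _)"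
    by (auto intro: injI simp: vec_lambda_inject)
  have fu_meas: "(\<lambda>x. f (u x)) \<in> borel_measurable ?P"
    using measurable_compose[OF measurable_embed_measure2[OF inj] f_meas[unfolded exterior_prob_def]]
    by (simp add: u_proj)
  have h_meas [measurable]: "h \<alpha> \<in> borel_measurable ?P" for \<alpha>
    unfolding h_def by (rule measurable_compose[OF fu_meas component_meas])
  have "\<exists>B. \<forall>x. norm (h \<alpha> x) \<le> B" for \<alpha>
  proof -
    have "compact ((\<lambda>w. f w $ \<alpha>) ` torus lam)"
      using cont compact_torus by (rule compact_continuous_image)
    then obtain B where "\<forall>w\<in>torus lam. norm (f w $ \<alpha>) \<le> B"
      by (auto dest!: compact_imp_bounded simp: bounded_iff)
    thus ?thesis using u_torus by (auto simp: h_def)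
  qed
  then obtain B where B: "norm (h \<alpha> x) \<le> B \<alpha>" for \<alpha> x by metis
  note [measurable] = torus_character_measurable
  have cnj_meas [measurable]: "cnj \<in> borel_measurable borel"
    by (intro borel_measurable_continuous_onI continuous_intros)
  have hh: "integrable ?P (\<lambda>x. cnj (h \<alpha> x) * h \<alpha> x)" for \<alpha>
    using B[of \<alpha>] order_trans[OF norm_ge_zero B[of \<alpha>]]
    by (intro P.integrable_const_bound[where B = "B \<alpha> * B \<alpha>"]) (auto simp: norm_mult mult_mono)
  have eh: "integrable ?P (\<lambda>x. cnj (?e i x) * h \<alpha> x)" for i \<alpha>
    using B[of \<alpha>] by (intro P.integrable_const_bound[where B = "B \<alpha>"]) (auto simp: norm_mult)
  have ee: "integrable ?P (\<lambda>x. cnj (?e i x) * ?e j x)" for i j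
    by (intro P.integrable_const_bound[where B = 1]) (auto simp: norm_mult)
  have h_int: "integrable ?P (h \<alpha>)" for \<alpha>
    using B[of \<alpha>] by (intro P.integrable_const_bound[where B = "B \<alpha>"]) auto
  have "integrable ?P (\<lambda>x. f (u x))"
  proof (rule P.integrable_const_bound[OF _ fu_meas])
    have "norm (f (u x)) \<le> (\<Sum>\<alpha>\<in>UNIV. B \<alpha>)" for x
      using L2_set_le_sum[of UNIV "\<lambda>\<alpha>. norm (h \<alpha> x)"] sum_mono[of UNIV "\<lambda>\<alpha>. norm (h \<alpha> x)" B] B
      by (simp add: norm_vec_def h_def)
    thus "AE x in ?P. norm (f (u x)) \<le> (\<Sum>\<alpha>\<in>UNIV. B \<alpha>)" by simp
  qed
  \<comment> \<open>A coordinate is a bounded linear map, so it passes through the Bochner integral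
    of the integrable vector-valued function.\<close>
  hence expect: "expectation lam f $ \<alpha> = (LINT x|?P. h \<alpha> x)" for \<alpha>
    using integral_bounded_linear[OF bounded_linear_vec_nth, of ?P "\<lambda>x. f (u x)" \<alpha>]
    by (simp add: expectation_def integral_exterior_prob[OF f_meas] u_proj h_def)
  have "(\<lambda>w. \<Sum>\<alpha>\<in>UNIV. cnj (f (boundary_proj lam w) $ \<alpha>) * f (boundary_proj lam w) $ \<alpha>)
      \<in> borel_measurable (exterior_prob lam)"
    using measurable_compose[OF f_meas component_meas]
    by (intro borel_measurable_sum borel_measurable_times measurable_compose[OF _ cnj_meas])
  hence inner: "inner_prod lam f f = (\<Sum>\<alpha>\<in>UNIV. LINT x|?P. cnj (h \<alpha> x) * h \<alpha> x)"
    using hh by (simp add: inner_prod_def integral_exterior_prob u_proj h_def)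
  have coeff: "(norm (\<eta> $ \<alpha> $ \<beta>))\<^sup>2 = lam\<^sup>2 * (norm (LINT x|?P. cnj (?e (Some \<beta>) x) * h \<alpha> x))\<^sup>2" for \<alpha> \<beta>
    using residue_matrix_eq_character_coefficient[OF lam cont, of \<alpha> \<beta>]
    by (simp add: assms(4) h_def u_def norm_mult power_mult_distrib)
  have bessel: "(norm (expectation lam f $ \<alpha>))\<^sup>2
      + (\<Sum>\<beta>\<in>UNIV. (norm (LINT x|?P. cnj (?e (Some \<beta>) x) * h \<alpha> x))\<^sup>2)
      \<le> Re (LINT x|?P. cnj (h \<alpha> x) * h \<alpha> x)" for \<alpha>
  proof -
    \<comment> \<open>The index \<open>None\<close> is the constant character and yields the
      expectation; the indices \<open>Some\<close> yield the residues.\<close>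
    have "(\<Sum>i\<in>UNIV. (norm (LINT x|?P. cnj (?e i x) * h \<alpha> x))\<^sup>2) \<le> Re (LINT x|?P. cnj (h \<alpha> x) * h \<alpha> x)"
      by (rule bessel_inequality[OF _ hh eh ee])
        (simp_all add: torus_character_orthonormal[OF lam] bessel_index_inject)
    thus ?thesis
      by (simp add: UNIV_option_conv sum.reindex torus_character_bessel_index(1) expect)
  qed
  have "(norm (expectation lam f))\<^sup>2 = (\<Sum>\<alpha>\<in>UNIV. (norm (expectation lam f $ \<alpha>))\<^sup>2)"
    by (simp add: norm_vec_def L2_set_def sum_nonneg)
  moreover have "(\<Sum>\<alpha>\<in>UNIV. (norm (expectation lam f $ \<alpha>))\<^sup>2
        + (\<Sum>\<beta>\<in>UNIV. (norm (LINT x|?P. cnj (?e (Some \<beta>) x) * h \<alpha> x))\<^sup>2))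
      \<le> (\<Sum>\<alpha>\<in>UNIV. Re (LINT x|?P. cnj (h \<alpha> x) * h \<alpha> x))"
    by (rule sum_mono) (rule bessel)
  \<comment> \<open>Moving the squared norm of the expectation to the other side turns the second
    moment into the variance.\<close>
  ultimately have "(\<Sum>\<alpha>\<in>UNIV. \<Sum>\<beta>\<in>UNIV. (norm (LINT x|?P. cnj (?e (Some \<beta>) x) * h \<alpha> x))\<^sup>2)
      \<le> ext_variance lam f"
    by (simp add: ext_variance_def inner sum.distrib)
  hence "Re (trace (conj_transpose \<eta> ** \<eta>)) \<le> lam\<^sup>2 * ext_variance lam f"
    by (simp add: trace_conj_transpose coeff sum_distrib_left[symmetric] mult_left_mono)
  hence "sqrt (Re (trace (conj_transpose \<eta> ** \<eta>))) \<le> sqrt (lam\<^sup>2 * ext_variance lam f)"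
    by (rule real_sqrt_le_mono)
  also have "\<dots> = lam * std_error lam f"
    using lam by (simp add: std_error_def real_sqrt_mult)
  finally show ?thesis .
qed

end
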